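(* Let $\Bbbk$ be a field of characteristic $0$ and let $V$ be the Virasoro algebra over $\Bbbk$. The universal enveloping algebra $U(V)$ is neither left nor right noetherian.
   Context: The Virasoro algebra $V$ is the Lie algebra over $\Bbbk$ with basis $\{e_n\}_{n\in\mathbb Z}\cup\{c\}$ and Lie bracket $[e_n,c]=0$, $[e_n,e_m]=(m-n)e_{n+m}+\frac{c}{12}(m^3-m)\delta_{n+m,0}$. *)

theory Defs
  imports Complex_Main "HOL-Algebra.QuotRing" "HOL-Library.Poly_Mapping"
begin

section \<open>One-sided ideals and noetherian rings\<close>

locale left_ideal = additive_subgroup I R + ring R for I and R (structure) +
  assumes I_l_closed: "\<lbrakk>a \<in> I; x \<in> carrier R\<rbrakk> \<Longrightarrow> x \<otimes> a \<in> I"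

locale right_ideal = additive_subgroup I R + ring R for I and R (structure) +
  assumes I_r_closed: "\<lbrakk>a \<in> I; x \<in> carrier R\<rbrakk> \<Longrightarrow> a \<otimes> x \<in> I"

definition gen_left_ideal :: "('a, 'b) ring_scheme \<Rightarrow> 'a set \<Rightarrow> 'a set"
  where "gen_left_ideal R S = \<Inter>{I. left_ideal I R \<and> S \<subseteq> I}"

definition gen_right_ideal :: "('a, 'b) ring_scheme \<Rightarrow> 'a set \<Rightarrow> 'a set"
  where "gen_right_ideal R S = \<Inter>{I. right_ideal I R \<and> S \<subseteq> I}"

text \<open>The library's \<^locale>\<open>ideal\<close> is two-sided, so its notion of noetherian ring
  (based on \<^locale>\<open>ideal\<close>) does not express the one-sided conditions.\<close>

definition left_noetherian :: "('a, 'b) ring_scheme \<Rightarrow> bool"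
  where "left_noetherian R \<longleftrightarrow> ring R \<and>
    (\<forall>I. left_ideal I R \<longrightarrow> (\<exists>A \<subseteq> carrier R. finite A \<and> I = gen_left_ideal R A))"

definition right_noetherian :: "('a, 'b) ring_scheme \<Rightarrow> bool"
  where "right_noetherian R \<longleftrightarrow> ring R \<and>
    (\<forall>I. right_ideal I R \<longrightarrow> (\<exists>A \<subseteq> carrier R. finite A \<and> I = gen_right_ideal R A))"


section \<open>Lie algebras and universal enveloping algebras\<close>

locale lie_algebra = vector_space scale
  for scale :: "'k::field \<Rightarrow> 'l::ab_group_add \<Rightarrow> 'l" +
  fixes bracket :: "'l \<Rightarrow> 'l \<Rightarrow> 'l"
  assumes bracket_add_left: "bracket (x + x') y = bracket x y + bracket x' y"
    and bracket_add_right: "bracket x (y + y') = bracket x y + bracket x y'"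
    and bracket_scale_left: "bracket (scale a x) y = scale a (bracket x y)"
    and bracket_scale_right: "bracket x (scale a y) = scale a (bracket x y)"
    and bracket_self: "bracket x x = 0"
    and jacobi: "bracket x (bracket y z) + bracket y (bracket z x) + bracket z (bracket x y) = 0"

datatype 'a word = Word (letters: "'a list")

instantiation word :: (type) monoid_add
begin

definition zero_word :: "'a word"
  where "0 = Word []"

definition plus_word :: "'a word \<Rightarrow> 'a word \<Rightarrow> 'a word"
  where "v + w = Word (letters v @ letters w)"

instance
  by standard (simp_all add: zero_word_def plus_word_def)

end

text \<open>The product of finitely supported functions on a monoid is convolution, so the type
  below is the free associative unital \<open>'k\<close>-algebra on the set \<open>'a\<close>.\<close>

type_synonym ('a, 'k) free_algebra = "'a word \<Rightarrow>\<^sub>0 'k"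

definition gen :: "'a \<Rightarrow> ('a, 'k::field) free_algebra"
  where "gen x = Poly_Mapping.single (Word [x]) 1"

definition scalar :: "'k::field \<Rightarrow> ('a, 'k) free_algebra"
  where "scalar a = Poly_Mapping.single 0 a"

definition ring_of_type :: "'a::ring_1 ring"
  where "ring_of_type = \<lparr>carrier = UNIV, mult = (*), one = 1, zero = 0, add = (+)\<rparr>"

text \<open>The tensor algebra of the vector space \<open>'l\<close> is the free algebra on all vectors modulo
  the linear relations (the first two sets). Adding the third set gives the enveloping
  algebra \<open>T(L) / (x \<otimes> y - y \<otimes> x - [x, y])\<close>.\<close>

definition enveloping_relations ::
    "('k::field \<Rightarrow> 'l::ab_group_add \<Rightarrow> 'l) \<Rightarrow> ('l \<Rightarrow> 'l \<Rightarrow> 'l) \<Rightarrow> ('l, 'k) free_algebra set"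
  where "enveloping_relations scale bracket =
    {gen (x + y) - (gen x + gen y) | x y. True} \<union>
    {gen (scale a x) - scalar a * gen x | a x. True} \<union>
    {gen x * gen y - gen y * gen x - gen (bracket x y) | x y. True}"

definition universal_enveloping_algebra ::
    "('k::field \<Rightarrow> 'l::ab_group_add \<Rightarrow> 'l) \<Rightarrow> ('l \<Rightarrow> 'l \<Rightarrow> 'l) \<Rightarrow> ('l, 'k) free_algebra set ring"
  where "universal_enveloping_algebra scale bracket =
    ring_of_type Quot (Idl\<^bsub>ring_of_type\<^esub> (enveloping_relations scale bracket))"

lemma ring_ring_of_type: "ring (ring_of_type :: 'a::ring_1 ring)"
proof -
  have "\<exists>y. x + y = 0 \<and> y + x = 0" for x :: 'a
    by (rule exI[of _ "- x"]) simp
  then have "\<exists>y. y + x = 0" for x :: 'a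
    by blast
  then show ?thesis
    by (intro ringI abelian_groupI monoidI) (auto simp: ring_of_type_def algebra_simps)
qed

lemma ring_universal_enveloping_algebra: "ring (universal_enveloping_algebra scale bracket)"
  unfolding universal_enveloping_algebra_def
  by (intro ideal.quotient_is_ring ring.genideal_ideal ring_ring_of_type)
    (simp add: ring_of_type_def)


section \<open>The Virasoro algebra\<close>

datatype vir_basis = E int | C

type_synonym 'k virasoro = "vir_basis \<Rightarrow>\<^sub>0 'k"

definition vir_scale :: "'k::field_char_0 \<Rightarrow> 'k virasoro \<Rightarrow> 'k virasoro"
  where "vir_scale a = Poly_Mapping.map ((*) a)"

fun vir_basis_bracket :: "vir_basis \<Rightarrow> vir_basis \<Rightarrow> 'k::field_char_0 virasoro"
  where
    "vir_basis_bracket (E n) (E m) =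
      Poly_Mapping.single (E (n + m)) (of_int (m - n)) +
      (if n + m = 0 then Poly_Mapping.single C (of_int (m ^ 3 - m) / 12) else 0)"
  | "vir_basis_bracket (E n) C = 0"
  | "vir_basis_bracket C _ = 0"

definition vir_bracket :: "'k::field_char_0 virasoro \<Rightarrow> 'k virasoro \<Rightarrow> 'k virasoro"
  where "vir_bracket x y =
    (\<Sum>i\<in>Poly_Mapping.keys x. \<Sum>j\<in>Poly_Mapping.keys y.
      vir_scale (Poly_Mapping.lookup x i * Poly_Mapping.lookup y j) (vir_basis_bracket i j))"

lemma lookup_vir_scale [simp]:
  "Poly_Mapping.lookup (vir_scale a x) i = a * Poly_Mapping.lookup x i"
  by (simp add: vir_scale_def Poly_Mapping.map.rep_eq when_def)

interpretation vir: vector_space vir_scale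
  by standard (auto intro!: poly_mapping_eqI simp: lookup_add algebra_simps)

lemma vir_bracket_superset:
  assumes "finite A" "finite B" "Poly_Mapping.keys x \<subseteq> A" "Poly_Mapping.keys y \<subseteq> B"
  shows "vir_bracket x y = (\<Sum>i\<in>A. \<Sum>j\<in>B.
    vir_scale (Poly_Mapping.lookup x i * Poly_Mapping.lookup y j) (vir_basis_bracket i j))"
proof -
  have "vir_bracket x y = (\<Sum>i\<in>Poly_Mapping.keys x. \<Sum>j\<in>B.
      vir_scale (Poly_Mapping.lookup x i * Poly_Mapping.lookup y j) (vir_basis_bracket i j))"
    unfolding vir_bracket_def using assms
    by (intro sum.cong refl sum.mono_neutral_left) (auto simp: in_keys_iff)
  also have "\<dots> = (\<Sum>i\<in>A. \<Sum>j\<in>B.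
      vir_scale (Poly_Mapping.lookup x i * Poly_Mapping.lookup y j) (vir_basis_bracket i j))"
    using assms by (intro sum.mono_neutral_left) (auto simp: in_keys_iff)
  finally show ?thesis .
qed

lemma vir_bracket_add_left: "vir_bracket (x + x') y = vir_bracket x y + vir_bracket x' y"
proof -
  let ?A = "Poly_Mapping.keys x \<union> Poly_Mapping.keys x'"
  note s = vir_bracket_superset[of ?A "Poly_Mapping.keys y" _ y]
  show ?thesis
    by (subst (1 2 3) s)
      (auto simp: Poly_Mapping.keys_add lookup_add sum.distrib vir.scale_left_distrib distrib_right
        dest: subsetD[OF Poly_Mapping.keys_add])
qed

lemma vir_basis_bracket_swap: "vir_basis_bracket i j = - vir_basis_bracket j i"
proof (cases i; cases j)
  fix n m assume *: "i = E n" "j = E m"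
  show ?thesis
  proof (cases "n + m = 0")
    case True
    then have "n = - m" by simp
    then show ?thesis
      by (intro poly_mapping_eqI)
        (auto simp add: * lookup_add lookup_minus lookup_single when_def field_simps)
  next
    case False
    then show ?thesis
      by (intro poly_mapping_eqI)
        (auto simp: * lookup_single when_def add.commute)
  qed
qed auto

lemma vir_bracket_swap: "vir_bracket x y = - vir_bracket y x"
proof -
  have "vir_bracket x y = (\<Sum>j\<in>Poly_Mapping.keys y. \<Sum>i\<in>Poly_Mapping.keys x.
      vir_scale (Poly_Mapping.lookup x i * Poly_Mapping.lookup y j) (vir_basis_bracket i j))"
    unfolding vir_bracket_def by (rule sum.swap)
  also have "\<dots> = (\<Sum>j\<in>Poly_Mapping.keys y. \<Sum>i\<in>Poly_Mapping.keys x.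
      - vir_scale (Poly_Mapping.lookup y j * Poly_Mapping.lookup x i) (vir_basis_bracket j i))"
    by (intro sum.cong refl) (subst vir_basis_bracket_swap, simp add: mult.commute)
  finally show ?thesis
    by (simp add: vir_bracket_def sum_negf)
qed

lemma vir_bracket_add_right: "vir_bracket x (y + y') = vir_bracket x y + vir_bracket x y'"
  using vir_bracket_add_left[of y y' x] vir_bracket_swap[of x] by simp

lemma vir_bracket_scale_left: "vir_bracket (vir_scale a x) y = vir_scale a (vir_bracket x y)"
proof -
  have "Poly_Mapping.keys (vir_scale a x) \<subseteq> Poly_Mapping.keys x"
    by (auto simp: in_keys_iff)
  then show ?thesis
    by (subst vir_bracket_superset[of "Poly_Mapping.keys x" "Poly_Mapping.keys y"])
      (auto simp: vir_bracket_def vir.scale_sum_right mult.assoc)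
qed

lemma vir_bracket_scale_right: "vir_bracket x (vir_scale a y) = vir_scale a (vir_bracket x y)"
  using vir_bracket_scale_left[of a y x] vir_bracket_swap[of x] by simp

lemma vir_bracket_self: "vir_bracket x x = 0"
proof (rule poly_mapping_eqI)
  fix i
  have "Poly_Mapping.lookup (vir_bracket x x) i = - Poly_Mapping.lookup (vir_bracket x x) i"
    using arg_cong[OF vir_bracket_swap[of x x], of "\<lambda>z. Poly_Mapping.lookup z i"] by simp
  then show "Poly_Mapping.lookup (vir_bracket x x) i = Poly_Mapping.lookup 0 i"
    by (simp add: equal_neg_zero)
qed

lemma vir_induct [case_names zero basis add]:
  fixes x :: "'k::field_char_0 virasoro"
  assumes "P 0" and "\<And>a i. P (vir_scale a (Poly_Mapping.single i 1))"
    and "\<And>x y. P x \<Longrightarrow> P y \<Longrightarrow> P (x + y)"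
  shows "P x"
proof (induction x rule: update_induct)
  case const
  show ?case by fact
next
  case (update f a b)
  have "Poly_Mapping.update a b f = f + vir_scale b (Poly_Mapping.single a 1)"
    using update(1)
    by (intro poly_mapping_eqI)
      (auto simp: lookup_update lookup_add lookup_single when_def in_keys_iff)
  then show ?case using assms update by simp
qed

lemma vir_bracket_basis:
  "vir_bracket (Poly_Mapping.single i 1) (Poly_Mapping.single j 1) = vir_basis_bracket i j"
  by (simp add: vir_bracket_def)

lemma vir_bracket_zero [simp]: "vir_bracket 0 x = 0" "vir_bracket x 0 = 0"
  by (simp_all add: vir_bracket_def)

lemma single_conv_scale: "Poly_Mapping.single i a = vir_scale a (Poly_Mapping.single i 1)"
  by (intro poly_mapping_eqI) (simp add: lookup_single when_def)

lemma vir_bracket_single: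
  "vir_bracket (Poly_Mapping.single i a) (Poly_Mapping.single j b) =
    vir_scale (a * b) (vir_basis_bracket i j)"
  by (subst (1 2) single_conv_scale)
    (simp add: vir_bracket_scale_left vir_bracket_scale_right vir_bracket_basis mult.commute)

lemma vir_jacobi_basis:
  fixes i j k :: vir_basis
  defines "e \<equiv> \<lambda>i. Poly_Mapping.single i (1 :: 'k::field_char_0)"
  shows "vir_bracket (e i) (vir_bracket (e j) (e k)) + vir_bracket (e j) (vir_bracket (e k) (e i)) +
    vir_bracket (e k) (vir_bracket (e i) (e j)) = 0"
proof -
  have nested: "vir_bracket (e (E n)) (vir_bracket (e (E m)) (e (E p))) =
      Poly_Mapping.single (E (n + m + p)) (of_int ((p - m) * (m + p - n))) +
      (if n + m + p = 0 then Poly_Mapping.single C (of_int ((p - m) * ((m + p) ^ 3 - (m + p))) / 12)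
       else 0)" for n m p
  proof -
    have *: "vir_bracket (e (E n)) (if b then Poly_Mapping.single C r else 0) = 0" for b r
      by (simp add: e_def vir_bracket_single)
    have "vir_bracket (e (E n)) (vir_bracket (e (E m)) (e (E p))) =
        vir_scale (of_int (p - m)) (vir_basis_bracket (E n) (E (m + p)))"
      unfolding e_def vir_bracket_basis vir_basis_bracket.simps(1)[of m p] vir_bracket_add_right
        *[unfolded e_def] by (simp add: vir_bracket_single del: vir_basis_bracket.simps)
    also have "\<dots> = Poly_Mapping.single (E (n + m + p)) (of_int ((p - m) * (m + p - n))) +
      (if n + m + p = 0 then Poly_Mapping.single C (of_int ((p - m) * ((m + p) ^ 3 - (m + p))) / 12)
       else 0)"
      by (intro poly_mapping_eqI) (simp add: lookup_add lookup_single when_def add.assoc)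
    finally show ?thesis .
  qed
  have C0: "vir_bracket (e C) z = 0" "vir_bracket z (e C) = 0" for z
  proof -
    show "vir_bracket (e C) z = 0"
      by (simp add: vir_bracket_def e_def)
    then show "vir_bracket z (e C) = 0"
      using vir_bracket_swap[of z "e C"] by simp
  qed
  consider n m p where "i = E n" "j = E m" "k = E p" | "i = C \<or> j = C \<or> k = C"
    by (metis vir_basis.exhaust)
  then show ?thesis
  proof cases
    case 1
    have lin: "(p - m) * (m + p - n) + (n - p) * (p + n - m) + (m - n) * (n + m - p) = 0"
      by (simp add: algebra_simps)
    have cub: "(p - m) * ((m + p) ^ 3 - (m + p)) + (n - p) * ((p + n) ^ 3 - (p + n)) +
        (m - n) * ((n + m) ^ 3 - (n + m)) = 0" if "n + m + p = 0"
    proof -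
      have p: "p = - n - m" using that by simp
      show ?thesis unfolding p by (simp add: algebra_simps power3_eq_cube)
    qed
    have idx: "m + p + n = n + m + p" "p + n + m = n + m + p"
      by simp_all
    have split: "Poly_Mapping.single q a + Poly_Mapping.single q b + Poly_Mapping.single q c =
        Poly_Mapping.single q (a + b + c)" for q and a b c :: 'k
      by (simp add: single_add)
    have lin': "of_int ((p - m) * (m + p - n)) + of_int ((n - p) * (p + n - m)) +
        of_int ((m - n) * (n + m - p)) = (0 :: 'k)"
      using lin by (simp only: of_int_add[symmetric] of_int_0)
    have cub': "of_int ((p - m) * ((m + p) ^ 3 - (m + p))) / 12 +
        of_int ((n - p) * ((p + n) ^ 3 - (p + n))) / 12 +
        of_int ((m - n) * ((n + m) ^ 3 - (n + m))) / 12 = (0 :: 'k)" if "n + m + p = 0"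
      using cub[OF that] by (simp only: add_divide_distrib[symmetric] of_int_add[symmetric]) simp
    show ?thesis
    proof (cases "n + m + p = 0")
      case True
      show ?thesis
        using split[of "E (n + m + p)"] split[of C] lin' cub'[OF True]
        unfolding 1 nested idx by (simp add: True add_ac del: of_int_mult of_int_diff of_int_add)
          (metis (no_types, lifting) add.assoc add.commute add.left_commute add_0 single_zero)
    next
      case False
      show ?thesis
        unfolding 1 nested idx if_not_P[OF False] add_0_right split lin' by simp
    qed
  qed (auto simp: C0)
qed

theorem virasoro_lie_algebra:
  "lie_algebra (vir_scale :: 'k::field_char_0 \<Rightarrow> 'k virasoro \<Rightarrow> 'k virasoro) vir_bracket"
proof
  fix x y z :: "'k virasoro"
  note lin = vir_bracket_add_left vir_bracket_add_right vir_bracket_scale_left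
    vir_bracket_scale_right
  let ?J = "\<lambda>x y z. vir_bracket x (vir_bracket y z) + vir_bracket y (vir_bracket z x) +
    vir_bracket z (vir_bracket x y)"
  have Jadd: "?J (x + x') y z = ?J x y z + ?J x' y z" "?J x (y + y') z = ?J x y z + ?J x y' z"
    "?J x y (z + z') = ?J x y z + ?J x y z'" for x x' y y' z z' :: "'k virasoro"
    by (simp_all add: lin add_ac)
  have scale: "?J (vir_scale a x) y z = vir_scale a (?J x y z)"
    "?J x (vir_scale a y) z = vir_scale a (?J x y z)"
    "?J x y (vir_scale a z) = vir_scale a (?J x y z)" for a and x y z :: "'k virasoro"
    by (simp_all add: lin vir.scale_right_distrib)
  show "?J x y z = 0"
  proof (induction x rule: vir_induct)
    case (basis a i)
    have "?J (Poly_Mapping.single i 1) y z = 0"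
    proof (induction y rule: vir_induct)
      case (basis b j)
      have "?J (Poly_Mapping.single i 1) (Poly_Mapping.single j 1) z = 0"
      proof (induction z rule: vir_induct)
        case (basis c k)
        show ?case unfolding scale vir_jacobi_basis by simp
      next
        case (add u v)
        then show ?case by (simp only: Jadd add_0)
      qed simp
      then show ?case unfolding scale by simp
    next
      case (add u v)
      then show ?case by (simp only: Jadd add_0)
    qed simp
    then show ?case unfolding scale by simp
  next
    case (add u v)
    then show ?case by (simp only: Jadd add_0)
  qed simp
qed (rule vir_bracket_add_left vir_bracket_add_right vir_bracket_scale_left
    vir_bracket_scale_right vir_bracket_self)+

end

theory Submission
  imports Defs "HOL-Library.Product_Plus"
begin

text \<open>Let \<open>U = U(V)\<close> act on the tensor densities over the dual numbers \<open>k[\<epsilon>]\<close>, deformed around the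
  parameter at which \<open>v\<^sub>0\<close> is invariant: \<open>v\<^sub>0 x = \<chi>(x) v\<^sub>0 + \<epsilon> \<psi>(x)\<close>. If \<open>I\<close> is the
  annihilator of the undeformed densities, then \<open>\<psi>(x y) = \<chi>(x) \<psi>(y)\<close> for \<open>y \<in> I\<close>, so a finite set of
  generators of the left ideal \<open>I\<close> would confine \<open>\<psi>(I)\<close> to a finite-dimensional space. But the
  second differences \<open>e\<^sub>0 e\<^sub>n - 2 e\<^sub>1 e\<^bsub>n-1\<^esub> + e\<^sub>2 e\<^bsub>n-2\<^esub>\<close> lie in \<open>I\<close> and \<open>\<psi>\<close> maps them to
  \<open>-2 v\<^sub>n\<close>. The antipode identifies \<open>U\<close> with its opposite ring, which gives the right-hand case.\<close>

section \<open>Opposite rings and a criterion for failure of noetherianity\<close>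

definition opposite_ring :: "('a, 'b) ring_scheme \<Rightarrow> ('a, 'b) ring_scheme"
  where "opposite_ring R = R\<lparr>mult := \<lambda>x y. y \<otimes>\<^bsub>R\<^esub> x\<rparr>"

lemma opposite_ring_simps [simp]:
  "carrier (opposite_ring R) = carrier R"
  "x \<otimes>\<^bsub>opposite_ring R\<^esub> y = y \<otimes>\<^bsub>R\<^esub> x"
  "\<one>\<^bsub>opposite_ring R\<^esub> = \<one>\<^bsub>R\<^esub>"
  "\<zero>\<^bsub>opposite_ring R\<^esub> = \<zero>\<^bsub>R\<^esub>"
  "x \<oplus>\<^bsub>opposite_ring R\<^esub> y = x \<oplus>\<^bsub>R\<^esub> y"
  by (simp_all add: opposite_ring_def)

lemma ring_opposite_ring:
  fixes R (structure)
  assumes "ring R"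
  shows "ring (opposite_ring R)"
proof -
  interpret ring R by fact
  have "\<exists>y\<in>carrier R. y \<oplus> x = \<zero>" if "x \<in> carrier R" for x
    using that l_neg by blast
  then show ?thesis
    by (intro ringI abelian_groupI monoidI)
      (simp_all add: a_assoc m_assoc l_distr r_distr a_ac)
qed

lemma left_ideal_opposite_ring:
  assumes "ring R"
  shows "left_ideal I (opposite_ring R) \<longleftrightarrow> right_ideal I R"
  using assms ring_opposite_ring[OF assms]
  by (auto simp: left_ideal_def right_ideal_def left_ideal_axioms_def right_ideal_axioms_def
      additive_subgroup_def subgroup_def)
    (simp_all add: opposite_ring_def a_inv_def m_inv_def)

lemma right_noetherian_imp_left_noetherian_opposite_ring:
  assumes "right_noetherian R"
  shows "left_noetherian (opposite_ring R)"
proof -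
  have "ring R"
    using assms by (simp add: right_noetherian_def)
  then show ?thesis
    using assms
    by (simp add: left_noetherian_def right_noetherian_def ring_opposite_ring
        left_ideal_opposite_ring gen_left_ideal_def gen_right_ideal_def)
qed

text \<open>Surjectivity writes every element of \<open>R\<close> as some \<open>h x\<close>, so
  absorption carries over to the image. Closure of \<open>J\<close> under negation is not asked for
  separately, because - x is the multiple \<open>- 1 * x\<close>.\<close>

lemma ring_hom_image_left_ideal:
  fixes R (structure) and h :: "'a::ring_1 \<Rightarrow> 'r"
  assumes "ring R" and hom: "h \<in> ring_hom ring_of_type R" and surj: "range h = carrier R"
    and zero: "0 \<in> J" and add: "\<And>x y. x \<in> J \<Longrightarrow> y \<in> J \<Longrightarrow> x + y \<in> J"
    and mult: "\<And>x y. y \<in> J \<Longrightarrow> x * y \<in> J"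
  shows "left_ideal (h ` J) R"
proof -
  interpret ring R by fact
  interpret h: ring_hom_ring "ring_of_type :: 'a ring" R h
    by (intro ring_hom_ringI2 ring_ring_of_type hom) fact
  have h_add: "h (x + y) = h x \<oplus> h y" and h_mult: "h (x * y) = h x \<otimes> h y" for x y
    using h.hom_add[of x y] h.hom_mult[of x y] by (simp_all add: ring_of_type_def)
  have h_zero: "h 0 = \<zero>"
    using h.hom_zero by (simp add: ring_of_type_def)
  have carr: "h x \<in> carrier R" for x
    using surj by auto
  have neg: "\<ominus> h x = h (- 1 * x)" for x
    by (rule minus_equality) (simp_all add: carr h_add[symmetric] h_zero)
  show ?thesis
  proof (intro left_ideal.intro additive_subgroup.intro left_ideal_axioms.intro add.subgroupI)
    show "h ` J \<subseteq> carrier R" using carr by auto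
    show "h ` J \<noteq> {}" using zero by auto
    show "\<ominus> a \<in> h ` J" if "a \<in> h ` J" for a
    proof -
      from that obtain x where x: "x \<in> J" "a = h x" by auto
      have "\<ominus> a = h (- 1 * x)" using neg x by simp
      then show ?thesis using mult[OF x(1)] by blast
    qed
    show "a \<oplus> b \<in> h ` J" if "a \<in> h ` J" "b \<in> h ` J" for a b
      using that add by (auto simp: h_add[symmetric])
    show "x \<otimes> a \<in> h ` J" if "a \<in> h ` J" "x \<in> carrier R" for a x
      using that mult unfolding surj[symmetric] by (auto simp: h_mult[symmetric])
  qed (fact ring_axioms)+
qed

text \<open>In the application \<open>\<psi>\<close> is additive with \<open>\<psi> (x * y) = \<chi> x \<psi> y\<close> for a character \<open>\<chi>\<close>,
  so the supports of the generators bound the support of everything they generate.\<close>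

lemma not_left_noetherian_if_unbounded_support:
  fixes R (structure) and h :: "'a::ring_1 \<Rightarrow> 'r" and \<psi> :: "'a \<Rightarrow> 'i \<Rightarrow>\<^sub>0 'k::field"
  assumes "ring R" and hom: "h \<in> ring_hom ring_of_type R" and surj: "range h = carrier R"
    and ker: "\<And>x. h x = \<zero> \<Longrightarrow> \<psi> x = 0"
    and I: "0 \<in> I" "\<And>x y. x \<in> I \<Longrightarrow> y \<in> I \<Longrightarrow> x + y \<in> I" "\<And>x y. y \<in> I \<Longrightarrow> x * y \<in> I"
    and \<psi>_add: "\<And>x y. \<psi> (x + y) = \<psi> x + \<psi> y"
    and \<psi>_mult: "\<And>x y. y \<in> I \<Longrightarrow> Poly_Mapping.keys (\<psi> (x * y)) \<subseteq> Poly_Mapping.keys (\<psi> y)"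
    and unbounded: "infinite (\<Union>y\<in>I. Poly_Mapping.keys (\<psi> y))"
  shows "\<not> left_noetherian R"
proof
  assume "left_noetherian R"
  moreover have "left_ideal (h ` I) R"
    by (rule ring_hom_image_left_ideal) (use assms in auto)
  ultimately obtain A where A: "finite A" "h ` I = gen_left_ideal R A"
    by (auto simp: left_noetherian_def)
  have "A \<subseteq> h ` I"
    unfolding A(2) gen_left_ideal_def by auto
  then obtain B where B: "B \<subseteq> I" "finite B" "A = h ` B"
    using A(1) finite_subset_image by meson
  define S where "S = (\<Union>b\<in>B. Poly_Mapping.keys (\<psi> b))"
  define J where "J = {y \<in> I. Poly_Mapping.keys (\<psi> y) \<subseteq> S}"
  have \<psi>_zero: "\<psi> 0 = 0"
    using \<psi>_add[of 0 0] by simp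
  have "left_ideal (h ` J) R"
  proof (rule ring_hom_image_left_ideal[OF \<open>ring R\<close> hom surj])
    show "0 \<in> J" using I by (simp add: J_def \<psi>_zero)
    show "x + y \<in> J" if "x \<in> J" "y \<in> J" for x y
      using that I(2) Poly_Mapping.keys_add[of "\<psi> x" "\<psi> y"] by (auto simp: J_def \<psi>_add)
    show "x * y \<in> J" if "y \<in> J" for x y
      using that I(3) \<psi>_mult[of y x] by (auto simp: J_def)
  qed
  moreover have "A \<subseteq> h ` J"
    using B by (auto simp: J_def S_def)
  ultimately have sub: "h ` I \<subseteq> h ` J"
    unfolding A(2) gen_left_ideal_def by auto
  interpret ring R by fact
  interpret h: ring_hom_ring "ring_of_type :: 'a ring" R h
    by (intro ring_hom_ringI2 ring_ring_of_type hom) fact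
  have "Poly_Mapping.keys (\<psi> y) \<subseteq> S" if "y \<in> I" for y
  proof -
    \<comment> \<open>An element of \<open>I\<close> agrees with one of \<open>J\<close> only up to
      the kernel of \<open>h\<close>, but \<psi> is additive and vanishes on that kernel, so both
      have the same value under \<psi>.\<close>
    from that sub obtain j where j: "j \<in> J" "h y = h j" by auto
    have carr: "h x \<in> carrier R" for x
      using surj by auto
    have "h (y - j) \<oplus> h j = h ((y - j) + j)"
      using h.hom_add[of "y - j" j] by (simp add: ring_of_type_def)
    also have "\<dots> = \<zero> \<oplus> h j" using j carr by simp
    finally have "h (y - j) = \<zero>" using carr by (simp only: add.right_cancel zero_closed)
    then have "\<psi> y = \<psi> j"
      using ker \<psi>_add[of "y - j" j] by simp
    then show ?thesis using j by (simp add: J_def)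
  qed
  moreover have "finite S" using B by (simp add: S_def)
  ultimately show False
    using unbounded by (meson UN_least finite_subset)
qed


section \<open>Modules over the free algebra and the enveloping algebra\<close>

lemma poly_mapping_induct [case_names single add]:
  fixes p :: "'a \<Rightarrow>\<^sub>0 'b::monoid_add"
  assumes single: "\<And>i a. P (Poly_Mapping.single i a)"
    and add: "\<And>p q. P p \<Longrightarrow> P q \<Longrightarrow> P (p + q)"
  shows "P p"
proof (induction p rule: update_induct)
  case const
  show ?case using single[of undefined 0] by simp
next
  case (update f a b)
  have "Poly_Mapping.update a b f = f + Poly_Mapping.single a b"
    using update(1)
    by (intro poly_mapping_eqI)
      (auto simp: lookup_update lookup_add lookup_single when_def in_keys_iff)
  then show ?case using assms update by simp
qed

text \<open>Summing over the union of both supports makes the claim termwise. It yields the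
  additivity of maps given by their values on words, namely module actions and the antipode.\<close>

lemma sum_keys_add:
  fixes p q :: "'a \<Rightarrow>\<^sub>0 'b::monoid_add" and g :: "'a \<Rightarrow> 'b \<Rightarrow> 'c::comm_monoid_add"
  assumes "\<And>w. g w 0 = 0" "\<And>w a b. g w (a + b) = g w a + g w b"
  shows "(\<Sum>w\<in>Poly_Mapping.keys (p + q). g w (Poly_Mapping.lookup (p + q) w)) =
    (\<Sum>w\<in>Poly_Mapping.keys p. g w (Poly_Mapping.lookup p w)) +
    (\<Sum>w\<in>Poly_Mapping.keys q. g w (Poly_Mapping.lookup q w))"
proof -
  let ?K = "Poly_Mapping.keys p \<union> Poly_Mapping.keys q"
  have *: "(\<Sum>w\<in>Poly_Mapping.keys r. g w (Poly_Mapping.lookup r w)) =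
      (\<Sum>w\<in>?K. g w (Poly_Mapping.lookup r w))" if "Poly_Mapping.keys r \<subseteq> ?K" for r
    using that assms(1) by (intro sum.mono_neutral_left) (auto simp: in_keys_iff)
  show ?thesis
    by (subst (1 2 3) *) (simp_all add: Poly_Mapping.keys_add lookup_add assms(2) sum.distrib)
qed

text \<open>\<open>fold\<close> applies the leftmost letter first, so concatenation of words becomes
  a right module law: a product \<open>p * q\<close> acts by \<open>p\<close> and then by
  \<open>q\<close>.\<close>

definition right_action ::
    "('k::field \<Rightarrow> 'm \<Rightarrow> 'm::ab_group_add) \<Rightarrow> ('a \<Rightarrow> 'm \<Rightarrow> 'm) \<Rightarrow> ('a, 'k) free_algebra \<Rightarrow> 'm \<Rightarrow> 'm"
  where "right_action scale \<rho> p v =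
    (\<Sum>w\<in>Poly_Mapping.keys p. scale (Poly_Mapping.lookup p w) (fold \<rho> (letters w) v))"

locale free_algebra_module = vector_space scale
  for scale :: "'k::field \<Rightarrow> 'm::ab_group_add \<Rightarrow> 'm" +
  fixes \<rho> :: "'a \<Rightarrow> 'm \<Rightarrow> 'm"
  assumes \<rho>_add: "\<rho> x (v + w) = \<rho> x v + \<rho> x w"
    and \<rho>_scale: "\<rho> x (scale a v) = scale a (\<rho> x v)"
begin

abbreviation act where "act \<equiv> right_action scale \<rho>"

lemma fold_add: "fold \<rho> xs (v + w) = fold \<rho> xs v + fold \<rho> xs w"
  by (induction xs arbitrary: v w) (simp_all add: \<rho>_add)

lemma fold_scale: "fold \<rho> xs (scale a v) = scale a (fold \<rho> xs v)"
  by (induction xs arbitrary: v) (simp_all add: \<rho>_scale)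

lemma act_add_left: "act (p + q) v = act p v + act q v"
  unfolding right_action_def by (rule sum_keys_add) (simp_all add: scale_left_distrib)

lemma act_zero_left: "act 0 v = 0"
  by (simp add: right_action_def)

lemma act_diff_left: "act (p - q) v = act p v - act q v"
  using act_add_left[of "p - q" q v] by simp

lemma act_single: "act (Poly_Mapping.single w a) v = scale a (fold \<rho> (letters w) v)"
  by (simp add: right_action_def)

lemma act_gen: "act (gen x) v = \<rho> x v"
  by (simp add: gen_def act_single)

lemma act_scalar: "act (scalar a) v = scale a v"
  by (simp add: scalar_def act_single zero_word_def)

lemma act_add_right: "act p (v + w) = act p v + act p w"
  by (simp add: right_action_def fold_add scale_right_distrib sum.distrib)

lemma act_scale: "act p (scale a v) = scale a (act p v)"
  by (simp add: right_action_def fold_scale scale_sum_right mult.commute)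

lemma act_zero_right: "act p 0 = 0"
  using act_scale[of p 0 0] by simp

lemma act_mult: "act (p * q) v = act q (act p v)"
proof (induction p rule: poly_mapping_induct)
  case (single i a)
  show ?case
  proof (induction q rule: poly_mapping_induct)
    case (single j b)
    show ?case
      by (simp add: mult_single act_single plus_word_def fold_scale mult.commute)
  qed (simp add: distrib_left act_add_left)
qed (simp add: distrib_right act_add_left act_add_right)

lemma act_mem_subspace:
  assumes "subspace P" "\<And>x v. v \<in> P \<Longrightarrow> \<rho> x v \<in> P" "v \<in> P"
  shows "act p v \<in> P"
proof -
  have "fold \<rho> xs v \<in> P" for xs
    using assms(3) by (induction xs arbitrary: v) (simp_all add: assms(2))
  then show ?thesis
    unfolding right_action_def by (intro subspace_sum[OF assms(1)] subspace_scale[OF assms(1)])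
qed

end

lemma ideal_ring_of_typeI:
  fixes I :: "'a::ring_1 set"
  assumes "0 \<in> I" and "\<And>x y. x \<in> I \<Longrightarrow> y \<in> I \<Longrightarrow> x + y \<in> I"
    and l: "\<And>x y. y \<in> I \<Longrightarrow> x * y \<in> I" and r: "\<And>x y. x \<in> I \<Longrightarrow> x * y \<in> I"
  shows "ideal I ring_of_type"
proof (rule idealI[OF ring_ring_of_type])
  \<comment> \<open>The additive subgroup property comes from the image lemma applied to the
    identity map.\<close>
  have "left_ideal (id ` I) (ring_of_type :: 'a ring)"
    by (rule ring_hom_image_left_ideal[OF ring_ring_of_type])
      (use assms in \<open>auto simp: ring_hom_def ring_of_type_def\<close>)
  then show "subgroup I (add_monoid ring_of_type)"
    by (simp add: left_ideal_def additive_subgroup_def)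
qed (use l r in \<open>simp_all add: ring_of_type_def\<close>)

section \<open>The canonical projection onto the enveloping algebra and its modules\<close>

definition enveloping_ideal ::
    "('k::field \<Rightarrow> 'l::ab_group_add \<Rightarrow> 'l) \<Rightarrow> ('l \<Rightarrow> 'l \<Rightarrow> 'l) \<Rightarrow> ('l, 'k) free_algebra set"
  where "enveloping_ideal scale bracket =
    Idl\<^bsub>ring_of_type\<^esub> (enveloping_relations scale bracket)"

lemma ideal_enveloping_ideal: "ideal (enveloping_ideal scale bracket) ring_of_type"
  unfolding enveloping_ideal_def
  by (intro ring.genideal_ideal ring_ring_of_type) (simp add: ring_of_type_def)

lemma enveloping_ideal_least:
  assumes "ideal I ring_of_type" "enveloping_relations scale bracket \<subseteq> I"
  shows "enveloping_ideal scale bracket \<subseteq> I"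
  unfolding enveloping_ideal_def by (intro ring.genideal_minimal ring_ring_of_type assms)

lemma enveloping_relations_subset_ideal:
  "enveloping_relations scale bracket \<subseteq> enveloping_ideal scale bracket"
  unfolding enveloping_ideal_def
  by (intro ring.genideal_self ring_ring_of_type) (simp add: ring_of_type_def)

definition enveloping_proj ::
    "('k::field \<Rightarrow> 'l::ab_group_add \<Rightarrow> 'l) \<Rightarrow> ('l \<Rightarrow> 'l \<Rightarrow> 'l) \<Rightarrow>
      ('l, 'k) free_algebra \<Rightarrow> ('l, 'k) free_algebra set"
  where "enveloping_proj scale bracket p =
    enveloping_ideal scale bracket +>\<^bsub>ring_of_type\<^esub> p"

lemma enveloping_proj_hom:
  "enveloping_proj scale bracket \<in>
    ring_hom ring_of_type (universal_enveloping_algebra scale bracket)"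
  using ideal.rcos_ring_hom[OF ideal_enveloping_ideal[of scale bracket]]
  by (simp add: enveloping_proj_def[abs_def] universal_enveloping_algebra_def enveloping_ideal_def)

lemma range_enveloping_proj:
  "range (enveloping_proj scale bracket) = carrier (universal_enveloping_algebra scale bracket)"
  by (auto simp: enveloping_proj_def universal_enveloping_algebra_def enveloping_ideal_def
      FactRing_def A_RCOSETS_def' ring_of_type_def)

lemma enveloping_proj_eq_zero:
  assumes "enveloping_proj scale bracket p = \<zero>\<^bsub>universal_enveloping_algebra scale bracket\<^esub>"
  shows "p \<in> enveloping_ideal scale bracket"
proof -
  interpret ideal "enveloping_ideal scale bracket" ring_of_type
    by (rule ideal_enveloping_ideal)
  have "p \<in> enveloping_ideal scale bracket +>\<^bsub>ring_of_type\<^esub> p"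
    by (rule a_rcos_self) (simp add: ring_of_type_def)
  also have "\<dots> = enveloping_ideal scale bracket"
    using assms
    by (simp add: enveloping_proj_def universal_enveloping_algebra_def enveloping_ideal_def
        FactRing_def)
  finally show ?thesis .
qed

text \<open>The annihilator of a module is a two-sided ideal, so it is enough to kill the three
  families of relations, which correspond to the three conditions on \<rho>. In the commutator
  condition \<open>\<rho> x\<close> is applied first in the positive term because the action is on
  the right.\<close>

lemma enveloping_ideal_annihilates:
  fixes \<rho> :: "'l::ab_group_add \<Rightarrow> 'm::ab_group_add \<Rightarrow> 'm" and scale :: "'k::field \<Rightarrow> 'm \<Rightarrow> 'm"
  assumes "free_algebra_module scale \<rho>"
    and \<rho>: "\<And>x y v. \<rho> (x + y) v = \<rho> x v + \<rho> y v" "\<And>a x v. \<rho> (lscale a x) v = scale a (\<rho> x v)"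
      "\<And>x y v. \<rho> y (\<rho> x v) - \<rho> x (\<rho> y v) = \<rho> (bracket x y) v"
    and p: "p \<in> enveloping_ideal lscale bracket"
  shows "right_action scale \<rho> p v = 0"
proof -
  interpret free_algebra_module scale \<rho> by fact
  have "enveloping_ideal lscale bracket \<subseteq> {p. \<forall>v. act p v = 0}"
  proof (rule enveloping_ideal_least)
    show "ideal {p. \<forall>v. act p v = 0} ring_of_type"
      by (rule ideal_ring_of_typeI) (simp_all add: act_add_left act_zero_left act_zero_right act_mult)
    show "enveloping_relations lscale bracket \<subseteq> {p. \<forall>v. act p v = 0}"
      by (auto simp: enveloping_relations_def act_diff_left act_add_left act_mult act_gen
          act_scalar \<rho>_scale \<rho>)
  qed
  then show ?thesis using p by blast
qed


section \<open>The antipode\<close>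

definition antipode :: "('a, 'k::field) free_algebra \<Rightarrow> ('a, 'k) free_algebra"
  where "antipode p = (\<Sum>w\<in>Poly_Mapping.keys p. Poly_Mapping.single (Word (rev (letters w)))
    ((- 1) ^ length (letters w) * Poly_Mapping.lookup p w))"

lemma antipode_single: "antipode (Poly_Mapping.single w a) =
    Poly_Mapping.single (Word (rev (letters w))) ((- 1) ^ length (letters w) * a)"
  by (simp add: antipode_def)

lemma antipode_add: "antipode (p + q) = antipode p + antipode q"
  unfolding antipode_def by (rule sum_keys_add) (simp_all add: distrib_left single_add)

lemma antipode_zero: "antipode 0 = 0"
  by (simp add: antipode_def)

lemma antipode_diff: "antipode (p - q) = antipode p - antipode q"
  using antipode_add[of "p - q" q] by simp

lemma antipode_mult: "antipode (p * q) = antipode q * antipode p"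
proof (induction p rule: poly_mapping_induct)
  case (single i a)
  show ?case
  proof (induction q rule: poly_mapping_induct)
    case (single j b)
    show ?case
      by (simp add: mult_single antipode_single plus_word_def power_add mult_ac)
  qed (simp add: distrib_left distrib_right antipode_add)
qed (simp add: distrib_left distrib_right antipode_add)

lemma antipode_antipode: "antipode (antipode p) = p"
proof (induction p rule: poly_mapping_induct)
  case (single w a)
  have "(- 1) ^ n * ((- 1) ^ n * a) = a" for n
    by (cases "even n") simp_all
  then show ?case by (simp add: antipode_single)
qed (simp add: antipode_add)

lemma antipode_gen: "antipode (gen x) = - gen x"
  by (simp add: gen_def antipode_single single_uminus)

lemma antipode_scalar: "antipode (scalar a) = scalar a"
  by (simp add: scalar_def antipode_single zero_word_def)

lemma scalar_commute: "scalar a * p = p * scalar a"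
  by (induction p rule: poly_mapping_induct)
    (simp_all add: scalar_def mult_single mult.commute distrib_left distrib_right)

lemma antipode_enveloping_ideal:
  assumes "p \<in> enveloping_ideal scale bracket"
  shows "antipode p \<in> enveloping_ideal scale bracket"
proof -
  let ?K = "enveloping_ideal scale bracket"
  interpret ideal ?K ring_of_type
    by (rule ideal_enveloping_ideal)
  have K_add: "x + y \<in> ?K" if "x \<in> ?K" "y \<in> ?K" for x y
    using additive_subgroup.a_closed[OF is_additive_subgroup that] by (simp add: ring_of_type_def)
  have K_mult: "x * y \<in> ?K" "y * x \<in> ?K" if "x \<in> ?K" for x y
    using I_l_closed[OF that, of y] I_r_closed[OF that, of y] by (simp_all add: ring_of_type_def)
  have K_neg: "- x \<in> ?K" if "x \<in> ?K" for x
    using K_mult(1)[OF that, of "- 1"] by simp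
  have K_zero: "0 \<in> ?K"
    using additive_subgroup.zero_closed[OF is_additive_subgroup] by (simp add: ring_of_type_def)
  have "?K \<subseteq> {p. antipode p \<in> ?K}"
  proof (rule enveloping_ideal_least)
    show "ideal {p. antipode p \<in> ?K} ring_of_type"
      by (rule ideal_ring_of_typeI)
        (simp_all add: antipode_zero antipode_add antipode_mult K_zero K_add K_mult)
    have "antipode r \<in> ?K" if "r \<in> enveloping_relations scale bracket" for r
    proof -
      \<comment> \<open>Reversing a product of two generators costs no sign, whereas a single
        generator changes sign, so each commutator relation is negated. The scaling relations also
        need scalars to be central, since the antipode swaps the factors of
        \<open>scalar a * gen x\<close>.\<close>
      have "antipode r = - r"
        using that
        by (auto simp: enveloping_relations_def antipode_diff antipode_add antipode_mult
            antipode_gen antipode_scalar scalar_commute)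
      then show ?thesis
        using that enveloping_relations_subset_ideal[of scale bracket] by (simp add: K_neg subsetD)
    qed
    then show "enveloping_relations scale bracket \<subseteq> {p. antipode p \<in> ?K}" by auto
  qed
  then show ?thesis using assms by blast
qed

text \<open>The antipode reverses products, and the opposite multiplication reverses them back. The
  opposite ring thus becomes an image of the same free algebra, with no need for an antipode on the
  quotient itself.\<close>

lemma enveloping_proj_antipode_hom:
  "enveloping_proj scale bracket \<circ> antipode \<in>
    ring_hom ring_of_type (opposite_ring (universal_enveloping_algebra scale bracket))"
proof -
  have "antipode 1 = (1 :: ('a, 'b) free_algebra)"
    using antipode_scalar[of 1] by (simp add: scalar_def)
  with enveloping_proj_hom[of scale bracket] show ?thesis
    by (auto simp: ring_hom_def ring_of_type_def antipode_add antipode_mult)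
qed

lemma range_enveloping_proj_antipode:
  "range (enveloping_proj scale bracket \<circ> antipode) =
    carrier (universal_enveloping_algebra scale bracket)"
proof -
  have "surj (antipode :: ('a, 'b) free_algebra \<Rightarrow> _)"
    by (rule surjI[where f = antipode]) (rule antipode_antipode)
  then show ?thesis by (simp only: image_comp[symmetric] range_enveloping_proj)
qed


section \<open>Tensor densities\<close>

type_synonym 'k laurent = "int \<Rightarrow>\<^sub>0 'k"

text \<open>The derivation D = t d/dt of the Laurent polynomials, with
  \<open>Poly_Mapping.single n 1\<close> standing for the n-th power of t.\<close>

definition euler :: "'k::field_char_0 laurent \<Rightarrow> 'k laurent"
  where "euler = Poly_Mapping.mapp (\<lambda>n a. of_int n * a)"

lemma lookup_euler: "Poly_Mapping.lookup (euler f) n = of_int n * Poly_Mapping.lookup f n"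
  by (simp add: euler_def lookup_mapp when_def in_keys_iff)

lemma euler_single: "euler (Poly_Mapping.single n a) = Poly_Mapping.single n (of_int n * a)"
  by (intro poly_mapping_eqI) (simp add: lookup_euler lookup_single when_def)

lemma euler_zero: "euler 0 = 0"
  using euler_single[of 0 0] by simp

lemma euler_one: "euler 1 = (0 :: 'k::field_char_0 laurent)"
  using euler_single[of 0 "1 :: 'k"] by simp

lemma euler_add: "euler (f + g) = euler f + euler g"
  by (intro poly_mapping_eqI) (simp add: lookup_euler lookup_add distrib_left)

lemma euler_diff: "euler (f - g) = euler f - euler g"
  by (intro poly_mapping_eqI) (simp add: lookup_euler lookup_minus right_diff_distrib)

lemma euler_uminus: "euler (- f) = - euler f"
  by (intro poly_mapping_eqI) (simp add: lookup_euler)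

lemma euler_mult: "euler (f * g) = euler f * g + f * euler g"
proof (induction f rule: poly_mapping_induct)
  case (single m a)
  show ?case
  proof (induction g rule: poly_mapping_induct)
    case (single n b)
    show ?case
      by (simp add: mult_single euler_single single_add[symmetric] algebra_simps)
  qed (simp add: distrib_left euler_add)
qed (simp add: distrib_right euler_add)

section \<open>The Virasoro algebra modulo its centre\<close>

text \<open>The projection onto the Witt algebra: a Laurent polynomial F stands for the vector field
  F D, so the n-th basis element goes to the n-th power of t and the central element to 0.\<close>

definition vector_field :: "'k::field_char_0 virasoro \<Rightarrow> 'k laurent"
  where "vector_field = Poly_Mapping.map_key E"

lemma lookup_vector_field:
  "Poly_Mapping.lookup (vector_field x) n = Poly_Mapping.lookup x (E n)"
proof -
  have "inj E" by (simp add: inj_def)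
  then show ?thesis by (simp add: vector_field_def map_key.rep_eq)
qed

lemma vector_field_zero: "vector_field 0 = 0"
  by (intro poly_mapping_eqI) (simp add: lookup_vector_field)

lemma vector_field_add: "vector_field (x + y) = vector_field x + vector_field y"
  by (intro poly_mapping_eqI) (simp add: lookup_vector_field lookup_add)

text \<open>Scalars are treated as constant Laurent polynomials, so that module identities become
  identities in a commutative ring; this translates them back to coefficients.\<close>

lemma lookup_single_zero_mult:
  "Poly_Mapping.lookup (Poly_Mapping.single 0 a * f) (n :: int) =
    (a :: 'k::field_char_0) * Poly_Mapping.lookup f n"
  by (induction f rule: poly_mapping_induct)
    (simp_all add: mult_single lookup_single when_def distrib_left lookup_add)

lemma vector_field_scale:
  "vector_field (vir_scale a x) = Poly_Mapping.single 0 a * vector_field x"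
  by (intro poly_mapping_eqI) (simp add: lookup_vector_field lookup_single_zero_mult)

lemma vector_field_E:
  "vector_field (Poly_Mapping.single (E n) a) = Poly_Mapping.single n a"
  by (intro poly_mapping_eqI) (simp add: lookup_vector_field lookup_single when_def)

lemma vector_field_C: "vector_field (Poly_Mapping.single C a) = 0"
  by (intro poly_mapping_eqI) (simp add: lookup_vector_field lookup_single when_def)

lemma euler_scalar: "euler (Poly_Mapping.single 0 a * f) = Poly_Mapping.single 0 a * euler f"
  by (intro poly_mapping_eqI) (simp add: lookup_single_zero_mult lookup_euler)

text \<open>This is the commutator [F D, G D] = (F D(G) - D(F) G) D of vector fields; the central
  term of the Virasoro bracket disappears under the projection.\<close>

lemma vector_field_bracket:
  "vector_field (vir_bracket x y) =
    vector_field x * euler (vector_field y) - euler (vector_field x) * vector_field y"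
proof (induction x rule: poly_mapping_induct)
  case (single i a)
  show ?case
  proof (induction y rule: poly_mapping_induct)
    case (single j b)
    show ?case
    proof (cases i; cases j)
      fix n m assume ij: "i = E n" "j = E m"
      have "vector_field (vir_basis_bracket (E n) (E m)) =
          Poly_Mapping.single (n + m) (of_int (m - n) :: 'a)"
        by (auto simp: vector_field_add vector_field_zero vector_field_E vector_field_C)
      then show ?thesis
        by (simp add: ij vir_bracket_single vector_field_scale vector_field_E mult_single
            euler_single single_diff[symmetric] algebra_simps del: vir_basis_bracket.simps)
    qed (simp_all add: vir_bracket_single vector_field_C vector_field_zero euler_zero)
  qed (simp add: vir_bracket_add_right vector_field_add euler_add algebra_simps)
qed (simp add: vir_bracket_add_left vector_field_add euler_add algebra_simps)


text \<open>The tensor densities over the dual numbers \<open>k[\<epsilon>]\<close>, as a right module: on the basis \<open>v\<^sub>a\<close> the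
  action is \<open>v\<^sub>a e\<^sub>n = (n \<epsilon> - a) v\<^bsub>a+n\<^esub>\<close>, and the pair \<open>(f, g)\<close> stands for \<open>f + \<epsilon> g\<close>.\<close>

definition density_scale :: "'k::field_char_0 \<Rightarrow> 'k laurent \<times> 'k laurent \<Rightarrow> 'k laurent \<times> 'k laurent"
  where "density_scale a v = (Poly_Mapping.single 0 a * fst v, Poly_Mapping.single 0 a * snd v)"

definition density_action ::
    "'k::field_char_0 virasoro \<Rightarrow> 'k laurent \<times> 'k laurent \<Rightarrow> 'k laurent \<times> 'k laurent"
  where "density_action x v =
    (- (vector_field x * euler (fst v)),
     fst v * euler (vector_field x) - vector_field x * euler (snd v))"

interpretation density: free_algebra_module density_scale density_action
proof
  fix x :: "'k::field_char_0 virasoro" and a b :: 'k and v w :: "'k laurent \<times> 'k laurent"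
  show "density_scale a (v + w) = density_scale a v + density_scale a w"
    by (simp add: density_scale_def distrib_left)
  show "density_scale (a + b) v = density_scale a v + density_scale b v"
    by (simp add: density_scale_def distrib_right single_add)
  show "density_scale a (density_scale b v) = density_scale (a * b) v"
    by (simp add: density_scale_def mult.assoc[symmetric] mult_single)
  show "density_scale 1 v = v"
    by (simp add: density_scale_def)
  show "density_action x (v + w) = density_action x v + density_action x w"
    by (simp add: density_action_def euler_add algebra_simps)
  show "density_action x (density_scale a v) = density_scale a (density_action x v)"
    unfolding density_action_def density_scale_def fst_conv snd_conv euler_scalar
    by (simp add: right_diff_distrib mult_ac)
qed

text \<open>In the commutator of two actions the Leibniz rule makes the second derivatives of the
  density cancel, and what remains is the action of the bracket of the vector fields.\<close>

lemma enveloping_ideal_annihilates_densities: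
  assumes "p \<in> enveloping_ideal vir_scale vir_bracket"
  shows "density.act p v = 0"
proof (rule enveloping_ideal_annihilates[OF density.free_algebra_module_axioms _ _ _ assms])
  fix x y :: "'a virasoro" and a :: 'a and v :: "'a laurent \<times> 'a laurent"
  show "density_action (x + y) v = density_action x v + density_action y v"
    by (simp add: density_action_def vector_field_add euler_add algebra_simps)
  show "density_action (vir_scale a x) v = density_scale a (density_action x v)"
    unfolding density_action_def density_scale_def fst_conv snd_conv vector_field_scale euler_scalar
    by (simp add: right_diff_distrib mult_ac)
  show "density_action y (density_action x v) - density_action x (density_action y v) =
      density_action (vir_bracket x y) v"
    by (simp add: density_action_def vector_field_bracket euler_mult euler_diff euler_uminus
        algebra_simps)
qed

section \<open>The annihilator ideal and the first-order deformation\<close>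

text \<open>The vectors \<open>(0, f)\<close> are the multiples of \<epsilon>, a copy of the
  undeformed densities inside the deformed module; hence this is the ideal \<open>I\<close> of the
  overview.\<close>

definition density_annihilator :: "('k::field_char_0 virasoro, 'k) free_algebra set"
  where "density_annihilator = {p. \<forall>f. density.act p (0, f) = 0}"

text \<open>The map \<psi> of the overview, where \<open>(1, 0)\<close> is the vector
  \<open>v\<^sub>0\<close>.\<close>

definition deformation :: "('k::field_char_0 virasoro, 'k) free_algebra \<Rightarrow> 'k laurent"
  where "deformation p = snd (density.act p (1, 0))"

text \<open>The multiples of \<epsilon> form a submodule. So in a product \<open>p * q\<close> with
  \<open>q\<close> in the annihilator, \<open>p\<close> moves \<open>(0, f)\<close> within this
  submodule and \<open>q\<close> then kills the result: the annihilator absorbs factors on the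
  left.\<close>

lemma act_second_component: "\<exists>g. density.act p (0, f) = (0, g)"
proof -
  have "density.act p (0, f) \<in> {v. fst v = 0}"
    by (rule density.act_mem_subspace)
      (auto simp: density.subspace_def density_scale_def density_action_def
        euler_def mapp_def)
  then show ?thesis by (cases "density.act p (0, f)") auto
qed

text \<open>D kills constants, so a Lie algebra element sends \<open>v\<^sub>0\<close> to a multiple
  of \<epsilon>. The line through \<open>v\<^sub>0\<close> together with the multiples of \<epsilon>
  is therefore a submodule, and \<open>a\<close> is the value \<chi>(p) of the character.\<close>

lemma act_one: "\<exists>a g. density.act p (1, 0) = (Poly_Mapping.single 0 a, g)"
proof -
  have "density.act p (1, 0) \<in> {v. \<exists>a. fst v = Poly_Mapping.single 0 a}"
  proof (rule density.act_mem_subspace)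
    show "density.subspace {v. \<exists>a. fst v = Poly_Mapping.single 0 a}"
      by (auto simp: density.subspace_def density_scale_def mult_single
          intro: exI[of _ 0] simp flip: single_add)
    show "density_action x v \<in> {v. \<exists>a. fst v = Poly_Mapping.single 0 a}"
      if "v \<in> {v. \<exists>a. fst v = Poly_Mapping.single 0 a}" for x v
      using that by (auto simp: density_action_def euler_single intro: exI[of _ 0])
    show "(1, 0) \<in> {v. \<exists>a. fst v = Poly_Mapping.single 0 a}"
      by (auto intro: exI[of _ 1])
  qed
  then show ?thesis by (cases "density.act p (1, 0)") auto
qed

text \<open>Acting by \<open>p\<close> first leaves \<chi>(p) times \<open>v\<^sub>0\<close> plus a
  multiple of \<epsilon>, and \<open>q\<close> kills the latter. Left multiplication thus only
  rescales \<psi>(q) and cannot enlarge its support.\<close>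

lemma deformation_mult:
  assumes "q \<in> density_annihilator"
  shows "\<exists>a. deformation (p * q) = Poly_Mapping.single 0 a * deformation q"
proof -
  obtain a g where "density.act p (1, 0) = (Poly_Mapping.single 0 a, g)"
    using act_one by blast
  also have "\<dots> = density_scale a (1, 0) + (0, g)"
    by (simp add: density_scale_def)
  finally have "density.act (p * q) (1, 0) = density_scale a (density.act q (1, 0))"
    using assms
    by (simp add: density.act_mult density.act_add_right density.act_scale density_annihilator_def)
  then show ?thesis
    by (auto simp: deformation_def density_scale_def)
qed

text \<open>On \<open>(0, t\<^sup>a)\<close> the product \<open>e\<^sub>m e\<^bsub>n-m\<^esub>\<close> acts by \<open>a (a + m)\<close>, which is linear in \<open>m\<close>, and on \<open>(1, 0)\<close> it
  acts by \<open>- m\<^sup>2\<close>. The second difference in \<open>m\<close> therefore kills the former and not the latter.\<close>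

definition second_difference :: "int \<Rightarrow> ('k::field_char_0 virasoro, 'k) free_algebra"
  where "second_difference n =
    (let e = \<lambda>m. gen (Poly_Mapping.single (E m) 1)
     in (e 0 * e n - e 1 * e (n - 1)) - (e 1 * e (n - 1) - e 2 * e (n - 2)))"

lemma density_act_gen_gen:
  fixes m n :: int
  defines "e \<equiv> \<lambda>m. gen (Poly_Mapping.single (E m) 1) :: ('k::field_char_0 virasoro, 'k) free_algebra"
  shows "density.act (e m * e (n - m)) (0, f) =
      (0, Poly_Mapping.single n 1 * (euler (euler f) + of_int m * euler f))"
    and "density.act (e m * e (n - m)) (1, 0) = (0, Poly_Mapping.single n (- of_int (m ^ 2)))"
proof -
  \<comment> \<open>Differentiating the m-th power of t produces m as a coefficient, while the claim
    has it as a constant factor.\<close>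
  have "Poly_Mapping.single n (of_int m) = Poly_Mapping.single n 1 * (of_int m :: 'k laurent)"
    by (simp add: mult_single flip: single_of_int)
  then show "density.act (e m * e (n - m)) (0, f) =
      (0, Poly_Mapping.single n 1 * (euler (euler f) + of_int m * euler f))"
    by (simp add: e_def density.act_mult density.act_gen density_action_def vector_field_E
        euler_zero euler_mult euler_uminus euler_diff euler_single right_diff_distrib distrib_left
        mult_single mult.assoc[symmetric])
  show "density.act (e m * e (n - m)) (1, 0) = (0, Poly_Mapping.single n (- of_int (m ^ 2)))"
    by (simp add: e_def density.act_mult density.act_gen density_action_def vector_field_E
        euler_one euler_zero euler_single mult_single single_uminus power2_eq_square)
qed

lemma second_difference_in_annihilator:
  "(second_difference n :: ('k::field_char_0 virasoro, 'k) free_algebra) \<in> density_annihilator"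
  using density_act_gen_gen(1)[where 'k = 'k, of 0 n] density_act_gen_gen(1)[where 'k = 'k, of 1 n]
    density_act_gen_gen(1)[where 'k = 'k, of 2 n]
  by (simp add: density_annihilator_def second_difference_def Let_def density.act_diff_left
      distrib_left zero_prod_def)

lemma deformation_second_difference:
  "deformation (second_difference n) = Poly_Mapping.single n (- 2 :: 'k::field_char_0)"
proof -
  \<comment> \<open>The numeral in \<open>2 * f\<close> is a constant Laurent polynomial, so its
    effect on coefficients has to be spelled out.\<close>
  have "Poly_Mapping.lookup (2 * f) k = 2 * Poly_Mapping.lookup f k" for f :: "'k laurent" and k
    using lookup_single_zero_mult[of 2 f k] by simp
  then show ?thesis
    using density_act_gen_gen(2)[where 'k = 'k, of 0 n]
      density_act_gen_gen(2)[where 'k = 'k, of 1 n] density_act_gen_gen(2)[where 'k = 'k, of 2 n]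
    by (intro poly_mapping_eqI)
      (simp add: deformation_def second_difference_def Let_def density.act_diff_left
        lookup_minus lookup_single when_def)
qed

section \<open>Failure of both noetherian conditions\<close>

text \<open>Stated for any image of the free algebra whose kernel lies in the enveloping ideal, so
  that it covers the enveloping algebra and its opposite alike. The kernel condition ensures that
  \<psi>, defined on the free algebra, depends only on the image.\<close>

lemma not_left_noetherian_if_hom_image:
  fixes R (structure) and h :: "('k::field_char_0 virasoro, 'k) free_algebra \<Rightarrow> 'r"
  assumes "ring R" "h \<in> ring_hom ring_of_type R" "range h = carrier R"
    and ker: "\<And>p. h p = \<zero> \<Longrightarrow> p \<in> enveloping_ideal vir_scale vir_bracket"
  shows "\<not> left_noetherian R"
proof (rule not_left_noetherian_if_unbounded_support[OF assms(1-3),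
      where \<psi> = deformation and I = density_annihilator])
  show "deformation p = 0" if "h p = \<zero>" for p
    using enveloping_ideal_annihilates_densities[OF ker[OF that]] by (simp add: deformation_def)
  show "0 \<in> density_annihilator"
    by (simp add: density_annihilator_def density.act_zero_left)
  show "p + q \<in> density_annihilator" if "p \<in> density_annihilator" "q \<in> density_annihilator"
    for p q :: "('k virasoro, 'k) free_algebra"
    using that by (simp add: density_annihilator_def density.act_add_left)
  show "p * q \<in> density_annihilator" if "q \<in> density_annihilator"
    for p q :: "('k virasoro, 'k) free_algebra"
  proof -
    have "density.act q (density.act p (0, f)) = 0" for f
      using that act_second_component[of p f] by (auto simp: density_annihilator_def)
    then show ?thesis
      by (simp add: density_annihilator_def density.act_mult)
  qed
  show "deformation (p + q) = deformation p + deformation q"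
    for p q :: "('k virasoro, 'k) free_algebra"
    by (simp add: deformation_def density.act_add_left)
  show "Poly_Mapping.keys (deformation (p * q)) \<subseteq> Poly_Mapping.keys (deformation q)"
    if "q \<in> density_annihilator" for p q :: "('k virasoro, 'k) free_algebra"
    using deformation_mult[OF that, of p] by (auto simp: in_keys_iff lookup_single_zero_mult)
  \<comment> \<open>The second difference of total degree \<open>n\<close> has \<psi>-value -2 times
    the n-th power of t, nonzero in characteristic 0, so the supports exhaust all integers.\<close>
  have "n \<in> (\<Union>p\<in>density_annihilator :: ('k virasoro, 'k) free_algebra set.
      Poly_Mapping.keys (deformation p))" for n
    by (rule UN_I[OF second_difference_in_annihilator[of n]])
      (simp add: deformation_second_difference)
  then have "(\<Union>p\<in>density_annihilator :: ('k virasoro, 'k) free_algebra set.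
      Poly_Mapping.keys (deformation p)) = UNIV"
    by blast
  then show "infinite (\<Union>p\<in>density_annihilator :: ('k virasoro, 'k) free_algebra set.
      Poly_Mapping.keys (deformation p))"
    by (simp add: infinite_UNIV_int)
qed

theorem corollary3p13:
  shows "\<not> left_noetherian (universal_enveloping_algebra
            (vir_scale :: 'k::field_char_0 \<Rightarrow> 'k virasoro \<Rightarrow> 'k virasoro) vir_bracket)
       \<and> \<not> right_noetherian (universal_enveloping_algebra
            (vir_scale :: 'k::field_char_0 \<Rightarrow> 'k virasoro \<Rightarrow> 'k virasoro) vir_bracket)"
proof
  let ?U = "universal_enveloping_algebra
    (vir_scale :: 'k::field_char_0 \<Rightarrow> 'k virasoro \<Rightarrow> 'k virasoro) vir_bracket"
  let ?h = "enveloping_proj (vir_scale :: 'k \<Rightarrow> 'k virasoro \<Rightarrow> 'k virasoro) vir_bracket"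
  show "\<not> left_noetherian ?U"
    by (rule not_left_noetherian_if_hom_image[OF ring_universal_enveloping_algebra
          enveloping_proj_hom range_enveloping_proj enveloping_proj_eq_zero])
  have "\<not> left_noetherian (opposite_ring ?U)"
  proof (rule not_left_noetherian_if_hom_image[OF
        ring_opposite_ring[OF ring_universal_enveloping_algebra] enveloping_proj_antipode_hom])
    show "range (?h \<circ> antipode) = carrier (opposite_ring ?U)"
      by (simp only: range_enveloping_proj_antipode opposite_ring_simps)
    \<comment> \<open>Here \<open>antipode p\<close> lies in the enveloping ideal; the ideal is
      stable under the antipode, and a second application returns \<open>p\<close>.\<close>
    show "p \<in> enveloping_ideal vir_scale vir_bracket"
      if "(?h \<circ> antipode) p = \<zero>\<^bsub>opposite_ring ?U\<^esub>" for p
      using that antipode_enveloping_ideal[of "antipode p"] enveloping_proj_eq_zero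
      by (fastforce simp: antipode_antipode)
  qed
  then show "\<not> right_noetherian ?U"
    using right_noetherian_imp_left_noetherian_opposite_ring by blast
qed

end
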